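(* For $k\in\mathbb{N}$, $k\ge1$, let $Q_k=\{-1,1\}^k$ and $\mathcal{B}^k=\mathrm{Lin}\{r_0,r_1,\ldots,r_k\}\subset\mathbb{R}^{Q_k}$, where $r_0\equiv1$ and $r_j(\chi)=\chi_j$. Then $\log_2k$ is a sharp threshold of the sample size for the existence of the maximum likelihood estimator (MLE) for $e(\mathcal{B}^k)$ and i.i.d. uniform samples on $Q_k$. That is, for every $\varepsilon\in(0,1)$, if for each $k$ the random variables $X_1,X_2,\ldots$ are independent and uniformly distributed on $Q_k$, and $\nu=\nu(k)$ is the smallest $n\ge1$ such that the MLE for $e(\mathcal{B}^k)$ and $X_1,\ldots,X_n$ exists, then, as $k\to\infty$, $$\mathbb{P}\left(\nu<(1-\varepsilon)\log_2k\right)\to0\quad\text{and}\quad\mathbb{P}\left(\nu<(1+\varepsilon)\log_2k\right)\to1.$$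
   Context: The weight on $Q_k$ is $\mu(\chi)=2^{-k}$. For $\phi\in\mathbb{R}^{Q_k}$ let $e(\phi)=e^{\phi}/\sum_{x\in Q_k}e^{\phi(x)}\mu(x)$, and $e(\mathcal{B}^k)=\{e(\phi):\phi\in\mathcal{B}^k\}$. An element $\hat p\in e(\mathcal{B}^k)$ is the MLE for $e(\mathcal{B}^k)$ and $x_1,\ldots,x_n\in Q_k$ if $\prod_{i=1}^n\hat p(x_i)=\sup_{p\in e(\mathcal{B}^k)}\prod_{i=1}^np(x_i)$. The time $\nu$ equals $\inf\{n\ge1:\{X_1,\ldots,X_n\}\text{ is a set of uniqueness for }\mathcal{B}^k_+\}$, where $\mathcal{B}^k_+$ is the set of nonnegative functions in $\mathcal{B}^k$ and $U\subset Q_k$ is a set of uniqueness for $\mathcal{B}^k_+$ if the only $\phi\in\mathcal{B}^k_+$ vanishing on $U$ is $\phi=0$ (existence of the MLE for a sample is equivalent to the sample being a set of uniqueness). If no such $n$ exists, $\nu=\infty$. *)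

theory Defs
  imports "HOL-Probability.Probability"
begin

definition Q :: "nat \<Rightarrow> (nat \<Rightarrow> real) set" where
  "Q k = {1..k} \<rightarrow>\<^sub>E {-1, 1}"

definition rademacher :: "nat \<Rightarrow> (nat \<Rightarrow> real) \<Rightarrow> real" where
  "rademacher j x = (if j = 0 then 1 else x j)"

text \<open>Elements of \<open>\<real>\<^bsup>Q k\<^esup>\<close> are represented by functions that are \<^const>\<open>undefined\<close>
  outside \<open>Q k\<close>, so that equality of functions is equality on \<open>Q k\<close>.\<close>

definition B :: "nat \<Rightarrow> ((nat \<Rightarrow> real) \<Rightarrow> real) set" where
  "B k = {(\<lambda>x\<in>Q k. \<Sum>j=0..k. a j * rademacher j x) | a :: nat \<Rightarrow> real. True}"

definition weight :: "nat \<Rightarrow> (nat \<Rightarrow> real) \<Rightarrow> real" where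
  "weight k x = 1 / 2 ^ k"

definition expdens :: "nat \<Rightarrow> ((nat \<Rightarrow> real) \<Rightarrow> real) \<Rightarrow> (nat \<Rightarrow> real) \<Rightarrow> real" where
  "expdens k \<phi> = (\<lambda>x\<in>Q k. exp (\<phi> x) / (\<Sum>y\<in>Q k. exp (\<phi> y) * weight k y))"

text \<open>The supremum is taken in the reals; for samples in \<open>Q k\<close> and \<open>P = expdens k ` B k\<close> it is
  a genuine supremum, since then \<open>P\<close> is nonempty and its elements take values in
  \<open>{0..2 ^ k}\<close> on \<open>Q k\<close> (lemma \<open>expdens_bounds\<close>).\<close>

definition is_MLE ::
  "('x \<Rightarrow> real) set \<Rightarrow> (nat \<Rightarrow> 'x) \<Rightarrow> nat \<Rightarrow> ('x \<Rightarrow> real) \<Rightarrow> bool" where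
  "is_MLE P x n p \<longleftrightarrow>
     p \<in> P \<and> (\<Prod>i=1..n. p (x i)) = (SUP q\<in>P. \<Prod>i=1..n. q (x i))"

text \<open>The infimum in \<^typ>\<open>enat\<close> of the empty set is \<open>\<infinity>\<close>.\<close>

definition nu :: "nat \<Rightarrow> (nat \<Rightarrow> nat \<Rightarrow> real) \<Rightarrow> enat" where
  "nu k x = (INF n\<in>{n. n \<ge> 1 \<and> (\<exists>p. is_MLE (expdens k ` B k) x n p)}. enat n)"

lemma expdens_bounds:
  assumes "x \<in> Q k"
  shows "0 \<le> expdens k \<phi> x" "expdens k \<phi> x \<le> 2 ^ k"
proof -
  have fin: "finite (Q k)"
    unfolding Q_def by (intro finite_PiE) auto
  have le: "exp (\<phi> x) * weight k x \<le> (\<Sum>y\<in>Q k. exp (\<phi> y) * weight k y)"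
    by (rule member_le_sum) (use assms fin in \<open>auto simp: weight_def\<close>)
  have pos: "0 < exp (\<phi> x) * weight k x"
    by (simp add: weight_def)
  have S: "0 < (\<Sum>y\<in>Q k. exp (\<phi> y) * weight k y)"
    using le pos by linarith
  show "0 \<le> expdens k \<phi> x"
    using assms S by (simp add: expdens_def)
  have "exp (\<phi> x) \<le> 2 ^ k * (\<Sum>y\<in>Q k. exp (\<phi> y) * weight k y)"
    using le by (simp add: weight_def field_simps)
  then show "expdens k \<phi> x \<le> 2 ^ k"
    using assms S by (simp add: expdens_def pos_divide_le_eq)
qed

end

theory Submission
  imports Defs "HOL-Real_Asymp.Real_Asymp"
begin

text \<open>
  The idea is that everything factorises over the coordinates of the cube. A density
  \<open>exp \<phi>\<close> with \<open>\<phi>\<close> affine is a product of functions of one coordinate each, and after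
  normalisation the factor of coordinate \<open>j\<close> is \<open>1 + x j * t j\<close> with \<open>t j = tanh (a j)\<close>.
  Thus the exponential family consists of the products of \<open>k\<close> arbitrary nondegenerate laws on
  \<open>{-1, 1}\<close>, written in terms of their means \<open>t j\<close> in the open interval from \<open>-1\<close> to \<open>1\<close>
  (\<open>expdens_image_B\<close>).

  The likelihood of a sample is then a product of \<open>k\<close> unrelated one-parameter likelihoods. If
  coordinate \<open>j\<close> takes both signs in the sample, its factor is maximal at the empirical mean,
  which lies strictly between \<open>-1\<close> and \<open>1\<close>. If coordinate \<open>j\<close> is constant, its factor increases
  strictly as \<open>t j\<close> moves towards that constant, and no maximum exists. Hence, for a
  nonempty sample, the MLE exists exactly when no coordinate is constant on the sample
  (\<open>MLE_exists_iff\<close>); this is the concrete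
  form of being a set of uniqueness for the nonnegative affine functions.

  The condition survives enlarging the sample, so \<open>\<nu> \<le> N\<close> just says that no coordinate is
  constant on the first \<open>N\<close> points. Reading the sample as a matrix of independent signs, each of
  the \<open>k\<close> coordinates is independently constant with probability \<open>2 / 2 ^ N\<close>, so this event has
  probability exactly \<open>(1 - 2 / 2 ^ N) ^ k\<close> (\<open>prob_varies\<close>). It is small when \<open>2 ^ N\<close> is
  much smaller than \<open>k\<close> and close to \<open>1\<close> when \<open>2 ^ N\<close> is much larger, and that is the threshold:
  for \<open>N\<close> near \<open>d * log 2 k\<close> the quotient \<open>k / 2 ^ N\<close> is of order \<open>k powr (1 - d)\<close>
  (\<open>prob_nu_less_bounds\<close>).
\<close>

section \<open>The exponential family as a family of product densities\<close>

text \<open>For \<open>t j\<close> between \<open>-1\<close> and \<open>1\<close> this is the density, with respect to the uniform law on the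
  cube, of independent signs with means \<open>t 1, \<dots>, t k\<close>.\<close>

definition product_density :: "nat \<Rightarrow> (nat \<Rightarrow> real) \<Rightarrow> (nat \<Rightarrow> real) \<Rightarrow> real" where
  "product_density k t = (\<lambda>x\<in>Q k. \<Prod>j=1..k. (1 + x j * t j))"

lemma finite_Q: "finite (Q k)"
  unfolding Q_def by (intro finite_PiE) auto

lemma Q_nth: "x \<in> Q k \<Longrightarrow> j \<in> {1..k} \<Longrightarrow> x j = -1 \<or> x j = 1"
  unfolding Q_def by (auto simp: PiE_def Pi_def)

lemma card_Q: "card (Q k) = 2 ^ k"
  unfolding Q_def by (simp add: card_funcsetE numeral_2_eq_2)

lemma one_plus_sign_pos:
  fixes s t :: real
  assumes "s = -1 \<or> s = 1" "-1 < t" "t < 1"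
  shows "0 < 1 + s * t"
  using assms by auto

lemma exp_over_cosh:
  fixes s a :: real
  assumes "s = -1 \<or> s = 1"
  shows "exp (a * s) = cosh a * (1 + s * tanh a)"
proof -
  have "cosh a * (1 + s * tanh a) = cosh a + s * sinh a"
    by (simp add: tanh_def distrib_left)
  then show ?thesis
    using assms by (auto simp: cosh_plus_sinh cosh_minus_sinh)
qed

lemma tanh_artanh:
  fixes t :: real
  assumes "-1 < t" "t < 1"
  shows "tanh (artanh t) = t"
proof -
  have "exp (- 2 * artanh t) = (1 - t) / (1 + t)"
    using assms by (simp add: artanh_def exp_minus inverse_eq_divide)
  then have "tanh (artanh t) = (1 - (1 - t) / (1 + t)) / (1 + (1 - t) / (1 + t))"
    unfolding tanh_real_altdef by simp
  also have "\<dots> = t"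
    using assms by (simp add: divide_simps)
  finally show ?thesis .
qed

text \<open>The partition function factorises because the sum over the cube of a product of
  one-coordinate functions is the product of their sums; the constant coefficient \<open>a 0\<close>
  cancels.\<close>

lemma expdens_eq_product_density:
  "expdens k (\<lambda>x\<in>Q k. \<Sum>j=0..k. a j * rademacher j x) = product_density k (\<lambda>j. tanh (a j))"
proof -
  define \<phi> where "\<phi> = (\<lambda>x\<in>Q k. \<Sum>j=0..k. a j * rademacher j x)"
  let ?C = "exp (a 0) * (\<Prod>j=1..k. cosh (a j))"
  have num: "exp (\<phi> x) = exp (a 0) * (\<Prod>j=1..k. exp (a j * x j))" if "x \<in> Q k" for x
  proof -
    have "\<phi> x = a 0 + (\<Sum>j=1..k. a j * x j)"
      using that by (simp add: \<phi>_def sum.atLeast_Suc_atMost rademacher_def)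
    then show ?thesis
      by (simp add: exp_add exp_sum)
  qed
  have "(\<Sum>y\<in>Q k. exp (\<phi> y) * weight k y)
      = exp (a 0) / 2 ^ k * (\<Sum>y\<in>Q k. \<Prod>j=1..k. exp (a j * y j))"
    unfolding sum_distrib_left by (intro sum.cong refl) (simp add: num weight_def)
  also have "(\<Sum>y\<in>Q k. \<Prod>j=1..k. exp (a j * y j)) = (\<Prod>j=1..k. \<Sum>s\<in>{-1,1}. exp (a j * s))"
    unfolding Q_def by (rule prod_sum_PiE[symmetric]) simp_all
  also have "\<dots> = (\<Prod>j=1..k. 2 * cosh (a j))"
    by (intro prod.cong refl) (simp add: cosh_def)
  also have "exp (a 0) / 2 ^ k * \<dots> = ?C"
    by (simp add: prod.distrib)
  finally have den: "(\<Sum>y\<in>Q k. exp (\<phi> y) * weight k y) = ?C" .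
  have "exp (\<phi> x) = ?C * product_density k (\<lambda>j. tanh (a j)) x" if x: "x \<in> Q k" for x
  proof -
    have "(\<Prod>j=1..k. exp (a j * x j)) = (\<Prod>j=1..k. cosh (a j) * (1 + x j * tanh (a j)))"
      by (intro prod.cong refl exp_over_cosh Q_nth[OF x])
    with num[OF x] x show ?thesis
      by (simp add: product_density_def prod.distrib)
  qed
  moreover have "?C > 0"
    by (simp add: prod_pos)
  ultimately show ?thesis
    unfolding expdens_def \<phi>_def[symmetric] den
    by (auto simp: fun_eq_iff restrict_def product_density_def)
qed

lemma expdens_image_B:
  "expdens k ` B k = product_density k ` {t. \<forall>j\<in>{1..k}. -1 < t j \<and> t j < 1}"
proof (intro equalityI subsetI)
  fix p assume "p \<in> expdens k ` B k"
  then obtain a where "p = product_density k (\<lambda>j. tanh (a j))"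
    unfolding B_def by (auto simp: expdens_eq_product_density)
  moreover have "product_density k (\<lambda>j. tanh (a j))
      \<in> product_density k ` {t. \<forall>j\<in>{1..k}. -1 < t j \<and> t j < 1}"
    by (rule imageI) (simp add: tanh_real_gt_neg1 tanh_real_lt_1)
  ultimately show "p \<in> product_density k ` {t. \<forall>j\<in>{1..k}. -1 < t j \<and> t j < 1}"
    by simp
next
  fix p assume "p \<in> product_density k ` {t. \<forall>j\<in>{1..k}. -1 < t j \<and> t j < 1}"
  then obtain t where t: "\<forall>j\<in>{1..k}. -1 < t j \<and> t j < 1" and p: "p = product_density k t"
    by blast
  have "product_density k t = product_density k (\<lambda>j. tanh (artanh (t j)))"
    unfolding product_density_def using t by (intro restrict_ext prod.cong refl) (simp add: tanh_artanh)
  also have "\<dots> = expdens k (\<lambda>x\<in>Q k. \<Sum>j=0..k. artanh (t j) * rademacher j x)"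
    by (rule expdens_eq_product_density[symmetric])
  also have "\<dots> \<in> expdens k ` B k"
    unfolding B_def by (rule imageI, rule CollectI, rule exI, rule conjI, rule refl, rule TrueI)
  finally show "p \<in> expdens k ` B k"
    using p by simp
qed

section \<open>Existence of the maximum likelihood estimator\<close>

definition varies :: "nat \<Rightarrow> nat \<Rightarrow> (nat \<Rightarrow> nat \<Rightarrow> real) \<Rightarrow> bool" where
  "varies k n x \<longleftrightarrow> (\<forall>j\<in>{1..k}. \<exists>i\<in>{1..n}. \<exists>i'\<in>{1..n}. x i j \<noteq> x i' j)"

lemma varies_mono: "varies k m x \<Longrightarrow> m \<le> n \<Longrightarrow> varies k n x"
  unfolding varies_def by (meson atLeastAtMost_iff order_trans)

text \<open>The maximiser is the mean \<open>u\<close> of the signs. Indeed, by \<open>1 + z \<le> exp z\<close> the quotient of the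
  likelihoods at \<open>t\<close> and \<open>u\<close> is at most the exponential of \<open>(t - u)\<close> times the score
  \<open>\<Sum>i\<in>I. y i / (1 + y i * u)\<close>, and the score vanishes at the mean because
  \<open>y i / (1 + y i * u) = (y i - u) / (1 - u\<^sup>2)\<close> when \<open>y i\<close> is a sign.\<close>

lemma sign_likelihood_has_max:
  fixes y :: "'i \<Rightarrow> real"
  assumes fin: "finite I" and sign: "\<And>i. i \<in> I \<Longrightarrow> y i = -1 \<or> y i = 1"
    and ne: "p \<in> I" "q \<in> I" "y p \<noteq> y q"
  shows "\<exists>u. -1 < u \<and> u < 1 \<and>
    (\<forall>t. -1 < t \<and> t < 1 \<longrightarrow> (\<Prod>i\<in>I. 1 + y i * t) \<le> (\<Prod>i\<in>I. 1 + y i * u))"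
proof -
  define u where "u = (\<Sum>i\<in>I. y i) / card I"
  have c: "real (card I) > 0"
    using fin ne by (auto simp: card_gt_0_iff)
  obtain a b where ab: "a \<in> I" "y a = -1" "b \<in> I" "y b = 1"
    using sign[of p] sign[of q] ne by metis
  have "(\<Sum>i\<in>I. y i) < (\<Sum>i\<in>I. 1)"
    by (rule sum_strict_mono_ex1) (use fin sign ab in force)+
  moreover have "(\<Sum>i\<in>I. -1) < (\<Sum>i\<in>I. y i)"
    by (rule sum_strict_mono_ex1) (use fin sign ab in force)+
  ultimately have u: "-1 < u" "u < 1"
    using c by (auto simp: u_def field_simps)
  have u2: "1 - u\<^sup>2 > 0"
    using u by (simp add: abs_square_less_1 abs_less_iff)
  have "(\<Sum>i\<in>I. y i / (1 + y i * u)) = (\<Sum>i\<in>I. (y i - u) / (1 - u\<^sup>2))"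
  proof (rule sum.cong)
    fix i assume i: "i \<in> I"
    have "(1 - u\<^sup>2) * y i = (y i - u) * (1 + y i * u)"
      using sign[OF i] by (auto simp: algebra_simps power2_eq_square)
    then show "y i / (1 + y i * u) = (y i - u) / (1 - u\<^sup>2)"
      using one_plus_sign_pos[OF sign[OF i] u] u2 by (simp add: frac_eq_eq mult.commute)
  qed simp
  also have "\<dots> = 0"
    using c by (simp add: sum_divide_distrib[symmetric] sum_subtractf u_def)
  finally have score: "(\<Sum>i\<in>I. y i / (1 + y i * u)) = 0" .
  have "(\<Prod>i\<in>I. 1 + y i * t) \<le> (\<Prod>i\<in>I. 1 + y i * u)" if t: "-1 < t" "t < 1" for t
  proof -
    have "(\<Prod>i\<in>I. 1 + y i * t)
        \<le> (\<Prod>i\<in>I. (1 + y i * u) * exp ((t - u) * (y i / (1 + y i * u))))"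
    proof (rule prod_mono)
      fix i assume i: "i \<in> I"
      have pos: "0 < 1 + y i * u" "0 < 1 + y i * t"
        using one_plus_sign_pos[OF sign[OF i]] u t by auto
      have "1 + y i * t = (1 + y i * u) * (1 + (t - u) * (y i / (1 + y i * u)))"
        using pos by (simp add: field_simps)
      also have "\<dots> \<le> (1 + y i * u) * exp ((t - u) * (y i / (1 + y i * u)))"
        using pos by (intro mult_left_mono exp_ge_add_one_self) auto
      finally show "0 \<le> 1 + y i * t \<and>
          1 + y i * t \<le> (1 + y i * u) * exp ((t - u) * (y i / (1 + y i * u)))"
        using pos by simp
    qed
    also have "\<dots> = (\<Prod>i\<in>I. 1 + y i * u) * exp ((t - u) * (\<Sum>i\<in>I. y i / (1 + y i * u)))"
      by (simp add: prod.distrib exp_sum[OF fin, symmetric] sum_distrib_left)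
    finally show ?thesis
      by (simp add: score)
  qed
  with u show ?thesis
    by blast
qed

lemma likelihood_product_density:
  assumes "\<And>i. i \<in> {1..n} \<Longrightarrow> x i \<in> Q k"
  shows "(\<Prod>i=1..n. product_density k t (x i)) = (\<Prod>j=1..k. \<Prod>i=1..n. 1 + x i j * t j)"
proof -
  have "(\<Prod>i=1..n. product_density k t (x i)) = (\<Prod>i=1..n. \<Prod>j=1..k. 1 + x i j * t j)"
    using assms by (intro prod.cong) (auto simp: product_density_def)
  also have "\<dots> = (\<Prod>j=1..k. \<Prod>i=1..n. 1 + x i j * t j)"
    by (rule prod.swap)
  finally show ?thesis .
qed

text \<open>The boundedness of the densities makes the supremum a true upper bound, so being an MLE is
  the same as being a maximiser.\<close>

lemma is_MLE_iff_maximiser: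
  assumes x: "\<And>i. i \<in> {1..n} \<Longrightarrow> x i \<in> Q k"
  shows "is_MLE (expdens k ` B k) x n p \<longleftrightarrow> p \<in> expdens k ` B k \<and>
    (\<forall>q\<in>expdens k ` B k. (\<Prod>i=1..n. q (x i)) \<le> (\<Prod>i=1..n. p (x i)))"
proof -
  have "(\<Prod>i=1..n. q (x i)) \<le> (\<Prod>i=1..n. 2 ^ k)" if "q \<in> expdens k ` B k" for q
    using that x by (intro prod_mono) (auto simp: expdens_bounds)
  then have bdd: "bdd_above ((\<lambda>q. \<Prod>i=1..n. q (x i)) ` (expdens k ` B k))"
    by (meson bdd_aboveI2)
  show ?thesis
  proof (intro iffI conjI ballI)
    assume p: "is_MLE (expdens k ` B k) x n p"
    then show "p \<in> expdens k ` B k"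
      by (simp add: is_MLE_def)
    fix q assume "q \<in> expdens k ` B k"
    then show "(\<Prod>i=1..n. q (x i)) \<le> (\<Prod>i=1..n. p (x i))"
      using p cSUP_upper[OF _ bdd] by (auto simp only: is_MLE_def)
  next
    assume "p \<in> expdens k ` B k \<and>
      (\<forall>q\<in>expdens k ` B k. (\<Prod>i=1..n. q (x i)) \<le> (\<Prod>i=1..n. p (x i)))"
    then show "is_MLE (expdens k ` B k) x n p"
      unfolding is_MLE_def by (auto simp only: intro!: cSup_eq_maximum[symmetric])
  qed
qed

lemma MLE_exists_iff:
  assumes x: "\<And>i. i \<in> {1..n} \<Longrightarrow> x i \<in> Q k" and n: "n \<ge> 1"
  shows "(\<exists>p. is_MLE (expdens k ` B k) x n p) \<longleftrightarrow> varies k n x"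
proof
  let ?T = "{t. \<forall>j\<in>{1..k}. -1 < t j \<and> t j < (1::real)}"
  assume "varies k n x"
  have "\<exists>u. -1 < u \<and> u < 1 \<and>
      (\<forall>t. -1 < t \<and> t < 1 \<longrightarrow> (\<Prod>i=1..n. 1 + x i j * t) \<le> (\<Prod>i=1..n. 1 + x i j * u))"
    if j: "j \<in> {1..k}" for j
  proof -
    obtain p q where "p \<in> {1..n}" "q \<in> {1..n}" "x p j \<noteq> x q j"
      using \<open>varies k n x\<close> j unfolding varies_def by blast
    then show ?thesis
      using sign_likelihood_has_max[of "{1..n}" "\<lambda>i. x i j" p q] Q_nth[OF x j] by blast
  qed
  then obtain u where u: "\<And>j. j \<in> {1..k} \<Longrightarrow> -1 < u j \<and> u j < 1"
    and max: "\<And>j t. j \<in> {1..k} \<Longrightarrow> -1 < t \<and> t < 1 \<Longrightarrow>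
      (\<Prod>i=1..n. 1 + x i j * t) \<le> (\<Prod>i=1..n. 1 + x i j * u j)"
    by metis
  have "(\<Prod>i=1..n. product_density k t (x i)) \<le> (\<Prod>i=1..n. product_density k u (x i))"
    if t: "t \<in> ?T" for t
  proof -
    have "0 \<le> (\<Prod>i=1..n. 1 + x i j * t j)" if j: "j \<in> {1..k}" for j
      using one_plus_sign_pos[OF Q_nth[OF x j]] t j by (intro prod_nonneg) (force intro: less_imp_le)
    then have "(\<Prod>j=1..k. \<Prod>i=1..n. 1 + x i j * t j) \<le> (\<Prod>j=1..k. \<Prod>i=1..n. 1 + x i j * u j)"
      using max t by (intro prod_mono) auto
    then show ?thesis
      by (simp only: likelihood_product_density[OF x])
  qed
  moreover have "product_density k u \<in> product_density k ` ?T"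
    using u by (intro imageI) simp
  ultimately have "product_density k u \<in> expdens k ` B k \<and> (\<forall>q\<in>expdens k ` B k.
      (\<Prod>i=1..n. q (x i)) \<le> (\<Prod>i=1..n. product_density k u (x i)))"
    unfolding expdens_image_B by (blast elim: imageE)
  then have "is_MLE (expdens k ` B k) x n (product_density k u)"
    by (intro is_MLE_iff_maximiser[THEN iffD2] x)
  then show "\<exists>p. is_MLE (expdens k ` B k) x n p"
    by blast
next
  assume "\<exists>p. is_MLE (expdens k ` B k) x n p"
  then obtain t where t: "\<And>j. j \<in> {1..k} \<Longrightarrow> -1 < t j \<and> t j < 1"
    and mle: "is_MLE (expdens k ` B k) x n (product_density k t)"
    unfolding is_MLE_def expdens_image_B by blast
  show "varies k n x"
  proof (rule ccontr)
    assume "\<not> varies k n x"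
    then obtain j where j: "j \<in> {1..k}" and const: "\<And>i. i \<in> {1..n} \<Longrightarrow> x i j = x 1 j"
      unfolding varies_def using n by fastforce
    define s where "s = x 1 j"
    have s: "s = -1 \<or> s = 1"
      unfolding s_def using Q_nth[OF x j] n by auto
    \<comment> \<open>Moving the parameter of the constant coordinate halfway towards its constant value
      stays in the family and increases the likelihood.\<close>
    define t' where "t' = t(j := (t j + s) / 2)"
    have t': "-1 < t' l \<and> t' l < 1" if "l \<in> {1..k}" for l
      using t[OF that] s by (auto simp: t'_def)
    have pos: "0 < (\<Prod>i=1..n. 1 + x i l * t l)" if l: "l \<in> {1..k}" for l
      using one_plus_sign_pos[OF Q_nth[OF x l]] t[OF l] by (intro prod_pos) auto
    have "(\<Prod>i=1..n. 1 + x i j * t j) < (\<Prod>i=1..n. 1 + x i j * t' j)"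
    proof (rule prod_mono_strict)
      have gain: "0 < 1 + x i j * t j" "1 + x i j * t j < 1 + x i j * t' j" if "i \<in> {1..n}" for i
      proof -
        have "x i j = s"
          unfolding s_def using that by (rule const)
        then show "0 < 1 + x i j * t j" "1 + x i j * t j < 1 + x i j * t' j"
          using s t[OF j] by (auto simp: t'_def)
      qed
      show "1 \<in> {1..n}"
        using n by simp
      then show "1 + x 1 j * t j < 1 + x 1 j * t' j"
        by (rule gain)
      fix i assume "i \<in> {1..n}"
      then show "0 \<le> 1 + x i j * t j \<and> 1 + x i j * t j \<le> 1 + x i j * t' j"
          and "0 < 1 + x i j * t' j"
        using gain[of i] by auto
    qed simp
    moreover have "(\<Prod>l\<in>{1..k}-{j}. \<Prod>i=1..n. 1 + x i l * t l)
        = (\<Prod>l\<in>{1..k}-{j}. \<Prod>i=1..n. 1 + x i l * t' l)"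
      by (intro prod.cong) (auto simp: t'_def)
    moreover have "0 < (\<Prod>l\<in>{1..k}-{j}. \<Prod>i=1..n. 1 + x i l * t l)"
      by (rule prod_pos, rule pos) simp
    ultimately have "(\<Prod>l=1..k. \<Prod>i=1..n. 1 + x i l * t l)
        < (\<Prod>l=1..k. \<Prod>i=1..n. 1 + x i l * t' l)"
      using j by (simp add: prod.remove)
    then have "(\<Prod>i=1..n. product_density k t (x i)) < (\<Prod>i=1..n. product_density k t' (x i))"
      by (simp only: likelihood_product_density[OF x])
    moreover have "product_density k t' \<in> expdens k ` B k"
      unfolding expdens_image_B using t' by blast
    moreover have "\<forall>q\<in>expdens k ` B k.
        (\<Prod>i=1..n. q (x i)) \<le> (\<Prod>i=1..n. product_density k t (x i))"
      using mle by (simp only: is_MLE_iff_maximiser[OF x]) blast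
    ultimately show False
      using not_le by blast
  qed
qed

lemma nu_le_iff:
  assumes x: "\<And>i. i \<ge> 1 \<Longrightarrow> x i \<in> Q k" and n: "n \<ge> 1"
  shows "nu k x \<le> enat n \<longleftrightarrow> varies k n x"
proof -
  have S: "{n. n \<ge> 1 \<and> (\<exists>p. is_MLE (expdens k ` B k) x n p)} = {n. n \<ge> 1 \<and> varies k n x}"
    using MLE_exists_iff[of _ x k] x by auto
  have "nu k x \<le> enat n \<longleftrightarrow> nu k x < enat (Suc n)"
    by (cases "nu k x") auto
  also have "\<dots> \<longleftrightarrow> (\<exists>m. m \<ge> 1 \<and> varies k m x \<and> m \<le> n)"
    unfolding nu_def S INF_less_iff by auto
  also have "\<dots> \<longleftrightarrow> varies k n x"
    using n varies_mono by blast
  finally show ?thesis .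
qed

text \<open>The largest integer \<open>N\<close> strictly below the real bound \<open>c\<close> turns the strict comparison with
  a real into a statement about the first \<open>N\<close> sample points.\<close>

lemma nu_less_real_iff:
  assumes x: "\<And>i. i \<ge> 1 \<Longrightarrow> x i \<in> Q k" and N: "N \<ge> 1" "real N < c" "c \<le> real N + 1"
  shows "ereal_of_enat (nu k x) < ereal c \<longleftrightarrow> varies k N x"
proof -
  have "ereal_of_enat (nu k x) < ereal c \<longleftrightarrow> nu k x \<le> enat N"
    using N by (cases "nu k x") auto
  with nu_le_iff[OF x N(1)] show ?thesis
    by simp
qed

section \<open>The probability that no coordinate is constant\<close>

text \<open>The event splits into finitely many disjoint pieces, one for each value \<open>f \<in> A\<close> of the
  sample, and by independence every piece has the same probability.\<close>

lemma (in prob_space) prob_iid_uniform: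
  fixes X :: "'i \<Rightarrow> 'a \<Rightarrow> 'b"
  assumes S: "finite S" and indep: "indep_vars (\<lambda>_. count_space S) X I"
    and unif: "\<And>i. i \<in> I \<Longrightarrow> distr M (count_space S) (X i) = uniform_count_measure S"
    and J: "finite J" "J \<noteq> {}" "J \<subseteq> I" and A: "A \<subseteq> J \<rightarrow>\<^sub>E S"
  shows "prob {\<omega> \<in> space M. (\<lambda>i\<in>J. X i \<omega>) \<in> A} = card A / real (card S) ^ card J"
proof -
  have rv: "X i \<in> measurable M (count_space S)" if "i \<in> J" for i
    using indep J that unfolding indep_vars_def by blast
  define E where "E f = (\<Inter>i\<in>J. X i -` {f i} \<inter> space M)" for f
  have fA: "finite A"
    using A S J by (meson finite_PiE finite_subset)
  have point: "prob (X i -` {s} \<inter> space M) = 1 / card S" if i: "i \<in> J" and s: "s \<in> S" for i s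
  proof -
    have "prob (X i -` {s} \<inter> space M) = measure (distr M (count_space S) (X i)) {s}"
      using rv[OF i] s by (simp add: measure_distr)
    also have "\<dots> = 1 / card S"
      using unif[of i] i J s S by (auto simp: measure_uniform_count_measure)
    finally show ?thesis .
  qed
  have AS: "f i \<in> S" if "f \<in> A" "i \<in> J" for f i
    using A that by (meson PiE_mem subsetD)
  have probE: "prob (E f) = 1 / real (card S) ^ card J" if f: "f \<in> A" for f
  proof -
    have fS: "f i \<in> S" if "i \<in> J" for i
      using f AS that by blast
    have "prob (E f) = (\<Prod>i\<in>J. prob (X i -` {f i} \<inter> space M))"
      unfolding E_def using J fS by (intro indep_varsD[OF indep]) auto
    also have "\<dots> = (\<Prod>i\<in>J. 1 / card S)"
      by (intro prod.cong refl point fS)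
    finally show ?thesis
      by (simp add: power_one_over)
  qed
  have "{\<omega> \<in> space M. (\<lambda>i\<in>J. X i \<omega>) \<in> A} = (\<Union>f\<in>A. E f)"
  proof (intro equalityI subsetI)
    fix \<omega> assume "\<omega> \<in> {\<omega> \<in> space M. (\<lambda>i\<in>J. X i \<omega>) \<in> A}"
    then show "\<omega> \<in> (\<Union>f\<in>A. E f)"
      by (auto simp: E_def intro!: bexI[of _ "\<lambda>i\<in>J. X i \<omega>"])
  next
    fix \<omega> assume "\<omega> \<in> (\<Union>f\<in>A. E f)"
    then obtain f where f: "f \<in> A" "\<omega> \<in> E f"
      by blast
    then have "(\<lambda>i\<in>J. X i \<omega>) = f"
      using A J by (intro extensionalityI[of _ J]) (auto simp: E_def PiE_def)
    with f show "\<omega> \<in> {\<omega> \<in> space M. (\<lambda>i\<in>J. X i \<omega>) \<in> A}"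
      using J by (auto simp: E_def)
  qed
  also have "prob \<dots> = (\<Sum>f\<in>A. prob (E f))"
  proof (rule finite_measure_finite_Union[OF fA])
    have "E f \<in> events" if f: "f \<in> A" for f
    proof -
      have "X i -` {f i} \<inter> space M \<in> events" if "i \<in> J" for i
        using rv[OF that] AS[OF f that] by (intro measurable_sets) auto
      then show ?thesis
        unfolding E_def using J by (intro sets.finite_INT) auto
    qed
    then show "E ` A \<subseteq> events"
      by blast
    show "disjoint_family_on E A"
      unfolding disjoint_family_on_def
    proof (intro ballI impI)
      fix f g assume fg: "f \<in> A" "g \<in> A" "f \<noteq> g"
      then have "\<exists>i\<in>J. f i \<noteq> g i"
        using A by (meson PiE_ext subsetD)
      then show "E f \<inter> E g = {}"
        by (auto simp: E_def)
    qed
  qed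
  finally show ?thesis
    by (simp add: probE)
qed

lemma card_nonconstant_signs:
  assumes n: "n \<ge> 1"
  shows "card {g \<in> {1..n} \<rightarrow>\<^sub>E {-1, 1::real}. \<exists>i\<in>{1..n}. \<exists>i'\<in>{1..n}. g i \<noteq> g i'} = 2 ^ n - 2"
proof -
  define c where "c s = (\<lambda>i\<in>{1..n}. s :: real)" for s
  have cs: "c s 1 = s" for s
    using n by (simp add: c_def)
  then have ne: "c (-1) \<noteq> c 1"
    by (metis one_neq_neg_one)
  have "{g \<in> {1..n} \<rightarrow>\<^sub>E {-1, 1::real}. \<exists>i\<in>{1..n}. \<exists>i'\<in>{1..n}. g i \<noteq> g i'}
      = ({1..n} \<rightarrow>\<^sub>E {-1, 1}) - {c (-1), c 1}"
  proof (intro equalityI subsetI)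
    fix g assume g: "g \<in> ({1..n} \<rightarrow>\<^sub>E {-1, 1::real}) - {c (-1), c 1}"
    have "\<exists>i\<in>{1..n}. g i \<noteq> g 1"
    proof (rule ccontr)
      assume "\<not> ?thesis"
      then have const: "g i = g 1" if "i \<in> {1..n}" for i
        using that by blast
      have "g = c (g 1)"
      proof (rule extensionalityI[of _ "{1..n}"])
        show "g i = c (g 1) i" if "i \<in> {1..n}" for i
          using const[OF that] that unfolding c_def by (simp only: restrict_apply if_True)
      qed (use g in \<open>auto simp: c_def PiE_def\<close>)
      moreover have "g 1 = -1 \<or> g 1 = 1"
        using g n by (auto simp: PiE_def Pi_def)
      ultimately show False
        using g by auto
    qed
    moreover have "1 \<in> {1..n}"
      using n by simp
    ultimately show "g \<in> {g \<in> {1..n} \<rightarrow>\<^sub>E {-1, 1}. \<exists>i\<in>{1..n}. \<exists>i'\<in>{1..n}. g i \<noteq> g i'}"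
      using g by blast
  qed (auto simp: c_def)
  moreover have "{c (-1), c 1} \<subseteq> {1..n} \<rightarrow>\<^sub>E {-1, 1}"
    by (auto simp: c_def)
  ultimately show ?thesis
    using ne by (simp add: card_Diff_subset card_funcsetE numeral_2_eq_2)
qed

text \<open>Transposing the matrix of signs turns a sample of \<open>n\<close> points of the cube into a list of \<open>k\<close>
  columns of length \<open>n\<close>, and the condition then applies to each column separately.\<close>

lemma card_varies:
  assumes n: "n \<ge> 1"
  shows "card {f \<in> {1..n} \<rightarrow>\<^sub>E Q k. varies k n f} = (2 ^ n - 2) ^ k"
proof -
  let ?G = "{g \<in> {1..n} \<rightarrow>\<^sub>E {-1, 1::real}. \<exists>i\<in>{1..n}. \<exists>i'\<in>{1..n}. g i \<noteq> g i'}"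
  have "bij_betw (\<lambda>f. \<lambda>j\<in>{1..k}. \<lambda>i\<in>{1..n}. f i j)
      {f \<in> {1..n} \<rightarrow>\<^sub>E Q k. varies k n f} ({1..k} \<rightarrow>\<^sub>E ?G)"
  proof (rule bij_betwI[where g = "\<lambda>h. \<lambda>i\<in>{1..n}. \<lambda>j\<in>{1..k}. h j i"])
    show "(\<lambda>f. \<lambda>j\<in>{1..k}. \<lambda>i\<in>{1..n}. f i j)
        \<in> {f \<in> {1..n} \<rightarrow>\<^sub>E Q k. varies k n f} \<rightarrow> ({1..k} \<rightarrow>\<^sub>E ?G)"
    proof (intro funcsetI PiE_I)
      fix f j assume f: "f \<in> {f \<in> {1..n} \<rightarrow>\<^sub>E Q k. varies k n f}" and j: "j \<in> {1..k}"
      have "f i j \<in> {-1, 1}" if "i \<in> {1..n}" for i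
      proof -
        have "f i \<in> Q k"
          using f that by auto
        from Q_nth[OF this j] show ?thesis
          by auto
      qed
      then have "(\<lambda>i\<in>{1..n}. f i j) \<in> {1..n} \<rightarrow>\<^sub>E {-1, 1}"
        by (rule restrict_PiE_iff[THEN iffD2, rule_format])
      moreover have "\<exists>i\<in>{1..n}. \<exists>i'\<in>{1..n}. (\<lambda>i\<in>{1..n}. f i j) i \<noteq> (\<lambda>i\<in>{1..n}. f i j) i'"
        using f j unfolding varies_def by simp
      ultimately show "(\<lambda>j\<in>{1..k}. \<lambda>i\<in>{1..n}. f i j) j \<in> ?G"
        using j by simp
    qed auto
    show "(\<lambda>h. \<lambda>i\<in>{1..n}. \<lambda>j\<in>{1..k}. h j i)
        \<in> ({1..k} \<rightarrow>\<^sub>E ?G) \<rightarrow> {f \<in> {1..n} \<rightarrow>\<^sub>E Q k. varies k n f}"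
    proof (intro funcsetI CollectI conjI)
      fix h assume h: "h \<in> {1..k} \<rightarrow>\<^sub>E ?G"
      then have hG: "h j \<in> ?G" if "j \<in> {1..k}" for j
        using that by (rule PiE_mem)
      have "h j i \<in> {-1, 1}" if "j \<in> {1..k}" "i \<in> {1..n}" for i j
        using hG[OF that(1)] that(2) by (auto simp: PiE_def Pi_def)
      then show "(\<lambda>i\<in>{1..n}. \<lambda>j\<in>{1..k}. h j i) \<in> {1..n} \<rightarrow>\<^sub>E Q k"
        unfolding Q_def by auto
      show "varies k n (\<lambda>i\<in>{1..n}. \<lambda>j\<in>{1..k}. h j i)"
        unfolding varies_def using hG by fastforce
    qed
  next
    fix f assume "f \<in> {f \<in> {1..n} \<rightarrow>\<^sub>E Q k. varies k n f}"
    then have f: "f \<in> {1..n} \<rightarrow>\<^sub>E Q k"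
      by simp
    have "(\<lambda>j\<in>{1..k}. f i j) = f i" if "i \<in> {1..n}" for i
      using PiE_mem[OF f that] unfolding Q_def by (simp add: PiE_restrict)
    moreover have "f \<in> extensional {1..n}"
      using f by (simp add: PiE_def)
    ultimately show "(\<lambda>i\<in>{1..n}. \<lambda>j\<in>{1..k}. (\<lambda>j\<in>{1..k}. \<lambda>i\<in>{1..n}. f i j) j i) = f"
      by (intro extensionalityI[of _ "{1..n}" f]) (simp_all cong: restrict_cong)
  next
    fix h assume h: "h \<in> {1..k} \<rightarrow>\<^sub>E ?G"
    have "(\<lambda>i\<in>{1..n}. h j i) = h j" if "j \<in> {1..k}" for j
      using PiE_mem[OF h that] by (auto intro: PiE_restrict)
    moreover have "h \<in> extensional {1..k}"
      using h by (simp add: PiE_def)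
    ultimately show "(\<lambda>j\<in>{1..k}. \<lambda>i\<in>{1..n}. (\<lambda>i\<in>{1..n}. \<lambda>j\<in>{1..k}. h j i) i j) = h"
      by (intro extensionalityI[of _ "{1..k}" h]) (simp_all cong: restrict_cong)
  qed
  then have "card {f \<in> {1..n} \<rightarrow>\<^sub>E Q k. varies k n f} = card ({1..k} \<rightarrow>\<^sub>E ?G)"
    by (rule bij_betw_same_card)
  also have "\<dots> = (2 ^ n - 2) ^ k"
    by (subst card_PiE) (simp_all only: card_nonconstant_signs[OF n] prod_constant card_atLeastAtMost
      finite_atLeastAtMost diff_Suc_1)
  finally show ?thesis .
qed

lemma (in prob_space) prob_varies:
  fixes X :: "nat \<Rightarrow> 'a \<Rightarrow> nat \<Rightarrow> real"
  assumes indep: "indep_vars (\<lambda>_. count_space (Q k)) X {1..}"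
    and unif: "\<And>i. i \<ge> 1 \<Longrightarrow> distr M (count_space (Q k)) (X i) = uniform_count_measure (Q k)"
    and n: "n \<ge> 1"
  shows "prob {\<omega> \<in> space M. varies k n (\<lambda>i. X i \<omega>)} = (1 - 2 / 2 ^ n) ^ k"
proof -
  have XQ: "X i \<omega> \<in> Q k" if "i \<ge> 1" "\<omega> \<in> space M" for i \<omega>
    using indep that unfolding indep_vars_def by (auto dest!: bspec[of _ _ i] measurable_space)
  let ?A = "{f \<in> {1..n} \<rightarrow>\<^sub>E Q k. varies k n f}"
  have "{\<omega> \<in> space M. varies k n (\<lambda>i. X i \<omega>)}
      = {\<omega> \<in> space M. (\<lambda>i\<in>{1..n}. X i \<omega>) \<in> ?A}"
    using XQ by (auto simp: varies_def)
  also have "prob \<dots> = card ?A / real (card (Q k)) ^ card {1..n}"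
    using indep unif n by (intro prob_iid_uniform[where I = "{1..}"] finite_Q) auto
  also have "\<dots> = real ((2 ^ n - 2) ^ k) / (2 ^ k) ^ n"
    unfolding card_varies[OF n] card_Q by simp
  also have "\<dots> = real (2 ^ n - 2) ^ k / (2 ^ n) ^ k"
    by (simp add: power_mult[symmetric] mult.commute)
  also have "\<dots> = ((2 ^ n - 2) / 2 ^ n) ^ k"
    using n power_increasing[of 1 n "2::nat"] by (simp add: power_divide of_nat_diff)
  also have "\<dots> = (1 - 2 / 2 ^ n) ^ k"
    by (simp add: diff_divide_distrib)
  finally show ?thesis .
qed

section \<open>The threshold\<close>

text \<open>Rounding the real bound \<open>c\<close> down to an integer \<open>N\<close> costs at most a factor \<open>2\<close> in \<open>2 ^ N\<close>,
  which explains the constant \<open>4\<close> in the lower bound. The bounds themselves are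
  \<open>1 - z \<le> exp (- z)\<close> and Bernoulli's inequality for \<open>(1 - 2 / 2 ^ N) ^ k\<close>.\<close>

lemma (in prob_space) prob_nu_less_bounds:
  fixes X :: "nat \<Rightarrow> 'a \<Rightarrow> nat \<Rightarrow> real"
  assumes indep: "indep_vars (\<lambda>_. count_space (Q k)) X {1..}"
    and unif: "\<And>i. i \<ge> 1 \<Longrightarrow> distr M (count_space (Q k)) (X i) = uniform_count_measure (Q k)"
    and c: "c > 1"
  defines "p \<equiv> prob {\<omega> \<in> space M. ereal_of_enat (nu k (\<lambda>i. X i \<omega>)) < ereal c}"
  shows "p \<le> exp (- 2 * k / 2 powr c)" "1 - 4 * k / 2 powr c \<le> p"
proof -
  \<comment> \<open>The strict inequality \<open>N < c\<close> matters when \<open>c\<close> is an integer, so the floor of \<open>c\<close> would be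
    wrong.\<close>
  define N where "N = nat (\<lceil>c\<rceil> - 1)"
  have N: "N \<ge> 1" "real N < c" "c \<le> real N + 1"
    using c unfolding N_def by linarith+
  have XQ: "X i \<omega> \<in> Q k" if "i \<ge> 1" "\<omega> \<in> space M" for i \<omega>
    using indep that unfolding indep_vars_def by (auto dest!: bspec[of _ _ i] measurable_space)
  have "{\<omega> \<in> space M. ereal_of_enat (nu k (\<lambda>i. X i \<omega>)) < ereal c}
      = {\<omega> \<in> space M. varies k N (\<lambda>i. X i \<omega>)}"
    using nu_less_real_iff[OF _ N] XQ by auto
  then have p: "p = (1 - 2 / 2 ^ N) ^ k"
    unfolding p_def using prob_varies[OF indep unif N(1)] by simp
  have N2: "(2::real) ^ N = 2 powr N"
    by (simp add: powr_realpow)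
  have pow: "2 ^ N \<ge> (2::real)"
    using power_increasing[OF N(1), of "2::real"] by simp
  have le: "(2::real) ^ N \<le> 2 powr c"
    unfolding N2 using N by (intro powr_mono) auto
  have "2 powr c \<le> 2 powr (real N + 1)"
    using N by (intro powr_mono) auto
  then have ge: "2 powr c \<le> 2 * 2 ^ N"
    by (simp add: N2 powr_add)
  have "p \<le> exp (- 2 / 2 ^ N) ^ k"
    unfolding p using exp_ge_add_one_self[of "- 2 / 2 ^ N :: real"] pow by (intro power_mono) auto
  also have "\<dots> = exp (- (2 * k / 2 ^ N))"
    by (simp add: exp_of_nat_mult[symmetric] mult.commute)
  also have "2 * k / 2 powr c \<le> 2 * k / 2 ^ N"
    using le by (intro divide_left_mono) auto
  then have "exp (- (2 * k / 2 ^ N)) \<le> exp (- 2 * k / 2 powr c)"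
    by simp
  finally show "p \<le> exp (- 2 * k / 2 powr c)" .
  have "2 / 2 ^ N \<le> 4 / 2 powr c"
    using ge by (simp add: field_simps)
  then have "k * (2 / 2 ^ N) \<le> k * (4 / 2 powr c)"
    by (intro mult_left_mono) auto
  moreover have "1 + k * (- 2 / 2 ^ N) \<le> p"
    unfolding p using Bernoulli_inequality[of "- 2 / 2 ^ N :: real" k] pow by simp
  ultimately show "1 - 4 * k / 2 powr c \<le> p"
    by (simp add: algebra_simps)
qed

lemma two_powr_log: "k \<ge> 1 \<Longrightarrow> 2 powr (d * log 2 (real k)) = real k powr d"
  by (subst mult.commute) (simp add: powr_powr[symmetric])

theorem corollary3p11:
  fixes M :: "nat \<Rightarrow> 'a measure"
    and X :: "nat \<Rightarrow> nat \<Rightarrow> 'a \<Rightarrow> nat \<Rightarrow> real"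
    and \<epsilon> :: real
  assumes "\<And>k. k \<ge> 1 \<Longrightarrow> prob_space (M k)"
    and "\<And>k. k \<ge> 1 \<Longrightarrow> prob_space.indep_vars (M k) (\<lambda>_. count_space (Q k)) (X k) {1..}"
    and "\<And>k i. k \<ge> 1 \<Longrightarrow> i \<ge> 1 \<Longrightarrow>
           distr (M k) (count_space (Q k)) (X k i) = uniform_count_measure (Q k)"
    and "0 < \<epsilon>" and "\<epsilon> < 1"
  shows "((\<lambda>k. measure (M k) {\<omega> \<in> space (M k).
            ereal_of_enat (nu k (\<lambda>i. X k i \<omega>)) < ereal ((1 - \<epsilon>) * log 2 (real k))})
           \<longlonglongrightarrow> 0) \<and>
         ((\<lambda>k. measure (M k) {\<omega> \<in> space (M k).
            ereal_of_enat (nu k (\<lambda>i. X k i \<omega>)) < ereal ((1 + \<epsilon>) * log 2 (real k))})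
           \<longlonglongrightarrow> 1)"
proof -
  have p: "prob_space (M k)" if "k \<ge> 1" for k
    using assms(1) that .
  define P where "P d k = measure (M k) {\<omega> \<in> space (M k).
    ereal_of_enat (nu k (\<lambda>i. X k i \<omega>)) < ereal (d * log 2 (real k))}" for d k
  have ratio: "real k / 2 powr (d * log 2 (real k)) = real k powr (1 - d)" if "k \<ge> 1" for d k
    using that by (simp add: two_powr_log powr_diff)
  have large: "\<forall>\<^sub>F k in sequentially. k \<ge> 1 \<and> d * log 2 (real k) > 1" if "d > 0" for d
    using that by (intro eventually_conj eventually_ge_at_top) real_asymp
  have upper: "P d k \<le> exp (- 2 * real k powr (1 - d))"
    if k: "k \<ge> 1" and c: "d * log 2 (real k) > 1" for d k
    using prob_space.prob_nu_less_bounds(1)[OF p[OF k] assms(2)[OF k] assms(3)[OF k] c]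
    unfolding P_def ratio[OF k, symmetric] by simp
  have lower: "1 - 4 * real k powr (1 - d) \<le> P d k"
    if k: "k \<ge> 1" and c: "d * log 2 (real k) > 1" for d k
    using prob_space.prob_nu_less_bounds(2)[OF p[OF k] assms(2)[OF k] assms(3)[OF k] c]
    unfolding P_def ratio[OF k, symmetric] by simp
  have "P (1 - \<epsilon>) \<longlonglongrightarrow> 0"
  proof (rule real_tendsto_sandwich)
    show "\<forall>\<^sub>F k in sequentially. 0 \<le> P (1 - \<epsilon>) k"
      by (simp add: P_def)
    show "\<forall>\<^sub>F k in sequentially. P (1 - \<epsilon>) k \<le> exp (- 2 * real k powr \<epsilon>)"
      using large[of "1 - \<epsilon>"] \<open>\<epsilon> < 1\<close> upper[of _ "1 - \<epsilon>"] by (auto elim!: eventually_mono)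
    show "(\<lambda>k. exp (- 2 * real k powr \<epsilon>)) \<longlonglongrightarrow> 0"
      using \<open>0 < \<epsilon>\<close> by real_asymp
  qed simp
  moreover have "P (1 + \<epsilon>) \<longlonglongrightarrow> 1"
  proof (rule real_tendsto_sandwich)
    show "\<forall>\<^sub>F k in sequentially. 1 - 4 * real k powr - \<epsilon> \<le> P (1 + \<epsilon>) k"
      using large[of "1 + \<epsilon>"] \<open>0 < \<epsilon>\<close> lower[of _ "1 + \<epsilon>"] by (auto elim!: eventually_mono)
    show "\<forall>\<^sub>F k in sequentially. P (1 + \<epsilon>) k \<le> 1"
      using eventually_ge_at_top[of 1]
      by eventually_elim (simp add: P_def prob_space.prob_le_1[OF p])
    show "(\<lambda>k. 1 - 4 * real k powr - \<epsilon>) \<longlonglongrightarrow> 1"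
      using \<open>0 < \<epsilon>\<close> by real_asymp
  qed simp
  ultimately show ?thesis
    unfolding P_def by blast
qed

end
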